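(* Let $n\ge 2$ be an even integer and let $(V,\mu)$ be an $n$-ary partially associative algebra over $\mathbb{K}$, i.e. $\mu\in C^n(V)$ with $\mu\bullet\mu=0$. For $i\in\{0,1,\dots,n-2\}$ and every integer $k\ge 0$ let $$\delta_i^k: C^{i+k(n-1)}(V)\longrightarrow C^{i+(k+1)(n-1)}(V),\qquad \delta_i^k(\varphi)=(-1)^{m-1}\,\mu\bullet\varphi-\varphi\bullet\mu,\qquad m=i+k(n-1).$$ Then $\delta_i^{k+1}\circ\delta_i^k=0$ for every $i=0,1,\dots,n-2$ and every $k\ge 0$.
   Context: $\mathbb{K}$ is a field of characteristic $0$, $V$ is a $\mathbb{K}$-vector space, and $C^k(V)=\mathrm{Hom}_{\mathbb{K}}(V^{\otimes k},V)$ (with $V^{\otimes 0}=\mathbb{K}$). For $f\in C^r(V)$ and $g\in C^s(V)$, the Gerstenhaber product $f\bullet g=f\bullet_{r,s}g\in C^{r+s-1}(V)$ is $$f\bullet g(X_1\otimes\cdots\otimes X_{r+s-1})=\sum_{j=1}^{r}(-1)^{(j-1)(s-1)}f\big(X_1\otimes\cdots\otimes X_{j-1}\otimes g(X_j\otimes\cdots\otimes X_{j+s-1})\otimes X_{j+s}\otimes\cdots\otimes X_{r+s-1}\big)$$ (an empty sum, hence $0$, if $r=0$). An $n$-ary partially associative algebra is a pair $(V,\mu)$ with $\mu\in C^n(V)$ and $\mu\bullet\mu=0$. *)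

theory Defs
  imports Complex_Main
begin

text \<open>
  The vector space \<open>V\<close> is the type \<open>'v\<close> with scalar multiplication \<open>scale\<close>.
  By the universal property of the tensor power, \<open>Hom(V\<^sup>\<otimes>\<^sup>k, V)\<close> is the space of
  \<open>k\<close>-linear maps \<open>V\<^sup>k \<rightarrow> V\<close>. Such a map is encoded as a function on lists, where
  \<open>f [X\<^sub>1, \<dots>, X\<^sub>k]\<close> is the value at \<open>X\<^sub>1 \<otimes> \<dots> \<otimes> X\<^sub>k\<close>. Setting it to \<open>0\<close> on lists of any other
  length makes equality of cochains coincide with equality of functions. For \<open>k = 0\<close> only the
  value at \<open>[]\<close> remains, so the space is a copy of \<open>V\<close>.
\<close>

definition cochains :: "('k::field_char_0 \<Rightarrow> 'v::ab_group_add \<Rightarrow> 'v) \<Rightarrow> nat \<Rightarrow> ('v list \<Rightarrow> 'v) set"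
  where "cochains scale k =
    {f. (\<forall>xs. length xs \<noteq> k \<longrightarrow> f xs = 0) \<and>
        (\<forall>as bs. length as + 1 + length bs = k \<longrightarrow>
           Vector_Spaces.linear scale scale (\<lambda>x. f (as @ x # bs)))}"

text \<open>
  The sign exponents below are integers because the arity \<open>s\<close> (or \<open>m\<close>) may be \<open>0\<close>, where
  truncated subtraction would give the wrong sign.
\<close>

definition gerstenhaber_product ::
  "('k::field_char_0 \<Rightarrow> 'v::ab_group_add \<Rightarrow> 'v) \<Rightarrow> nat \<Rightarrow> nat \<Rightarrow>
     ('v list \<Rightarrow> 'v) \<Rightarrow> ('v list \<Rightarrow> 'v) \<Rightarrow> 'v list \<Rightarrow> 'v"
  where "gerstenhaber_product scale r s f g = (\<lambda>xs.
    if length xs = r + s - 1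
    then \<Sum>j=1..r. scale ((-1) powi ((int j - 1) * (int s - 1)))
           (f (take (j - 1) xs @ g (take s (drop (j - 1) xs)) # drop (j - 1 + s) xs))
    else 0)"

definition partially_associative ::
  "('k::field_char_0 \<Rightarrow> 'v::ab_group_add \<Rightarrow> 'v) \<Rightarrow> nat \<Rightarrow> ('v list \<Rightarrow> 'v) \<Rightarrow> bool"
  where "partially_associative scale n \<mu> \<longleftrightarrow>
    \<mu> \<in> cochains scale n \<and> gerstenhaber_product scale n n \<mu> \<mu> = (\<lambda>_. 0)"

definition delta ::
  "('k::field_char_0 \<Rightarrow> 'v::ab_group_add \<Rightarrow> 'v) \<Rightarrow> nat \<Rightarrow> ('v list \<Rightarrow> 'v) \<Rightarrow> nat \<Rightarrow> nat \<Rightarrow>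
     ('v list \<Rightarrow> 'v) \<Rightarrow> 'v list \<Rightarrow> 'v"
  where "delta scale n \<mu> i k \<phi> =
    (let m = i + k * (n - 1) in
     (\<lambda>xs. scale ((-1) powi (int m - 1)) (gerstenhaber_product scale n m \<mu> \<phi> xs)
           - gerstenhaber_product scale m n \<phi> \<mu> xs))"

lemma gerstenhaber_product_in_cochains:
  assumes vs: "vector_space scale"
    and f: "f \<in> cochains scale r" and g: "g \<in> cochains scale s"
  shows "gerstenhaber_product scale r s f g \<in> cochains scale (r + s - 1)"
proof -
  interpret V: vector_space scale by (rule vs)
  interpret VV: vector_space_pair scale scale by unfold_locales
  have fl: "Vector_Spaces.linear scale scale (\<lambda>x. f (as @ x # bs))"
    if "length as + 1 + length bs = r" for as bs
    using f that by (auto simp: cochains_def)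
  have gl: "Vector_Spaces.linear scale scale (\<lambda>x. g (as @ x # bs))"
    if "length as + 1 + length bs = s" for as bs
    using g that by (auto simp: cochains_def)
  have term_linear: "Vector_Spaces.linear scale scale (\<lambda>x.
      f (take q (as @ x # bs) @ g (take s (drop q (as @ x # bs))) # drop (q + s) (as @ x # bs)))"
    if len: "length as + 1 + length bs = r + s - 1" and q: "q < r" for q as bs
  proof -
    consider (left) "length as < q" | (mid) "q \<le> length as" "length as < q + s"
      | (right) "q + s \<le> length as" by linarith
    then show ?thesis
    proof cases
      case left
      define p where "p = q - length as - 1"
      have q': "q = length as + Suc p" using left by (simp add: p_def)
      have "Vector_Spaces.linear scale scale
          (\<lambda>x. f (as @ x # (take p bs @ g (take s (drop p bs)) # drop (p + s) bs)))"
        by (rule fl) (use len q q' in auto)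
      then show ?thesis by (simp add: q')
    next
      case mid
      define p where "p = q + s - length as - 1"
      have p: "q + s - length as = Suc p" "s - (length as - q) = Suc p"
        using mid by (simp_all add: p_def)
      have 1: "Vector_Spaces.linear scale scale (\<lambda>x. g (drop q as @ x # take p bs))"
        by (rule gl) (use len q mid in \<open>auto simp: p_def\<close>)
      have 2: "Vector_Spaces.linear scale scale (\<lambda>y. f (take q as @ y # drop p bs))"
        by (rule fl) (use len q mid in \<open>auto simp: p_def\<close>)
      have "Vector_Spaces.linear scale scale
          (\<lambda>x. f (take q as @ g (drop q as @ x # take p bs) # drop p bs))"
        using Vector_Spaces.linear_compose[OF 1 2] by (simp add: o_def)
      then show ?thesis using mid p by simp
    next
      case right
      define as' where "as' = take q as @ g (take s (drop q as)) # drop (q + s) as"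
      have "Vector_Spaces.linear scale scale (\<lambda>x. f (as' @ x # bs))"
        by (rule fl) (use len q right in \<open>auto simp: as'_def\<close>)
      then show ?thesis using right by (simp add: as'_def)
    qed
  qed
  have "Vector_Spaces.linear scale scale (\<lambda>x. gerstenhaber_product scale r s f g (as @ x # bs))"
    if len: "length as + 1 + length bs = r + s - 1" for as bs
  proof -
    have "Vector_Spaces.linear scale scale (\<lambda>x. \<Sum>j=1..r.
        scale ((-1) powi ((int j - 1) * (int s - 1)))
          (f (take (j - 1) (as @ x # bs) @ g (take s (drop (j - 1) (as @ x # bs))) #
              drop (j - 1 + s) (as @ x # bs))))"
      by (intro VV.linear_compose_sum ballI VV.linear_compose_scale_right term_linear)
        (use len in auto)
    moreover have "length (as @ x # bs) = r + s - 1" for x using len by simp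
    ultimately show ?thesis by (simp only: gerstenhaber_product_def if_True simp_thms)
  qed
  then show ?thesis
    by (auto simp: cochains_def gerstenhaber_product_def)
qed

lemma delta_in_cochains:
  assumes vs: "vector_space scale" and n: "n \<ge> 2"
    and mu: "\<mu> \<in> cochains scale n" and phi: "\<phi> \<in> cochains scale (i + k * (n - 1))"
  shows "delta scale n \<mu> i k \<phi> \<in> cochains scale (i + (k + 1) * (n - 1))"
proof -
  interpret V: vector_space scale by (rule vs)
  interpret VV: vector_space_pair scale scale by unfold_locales
  define m where "m = i + k * (n - 1)"
  have ar: "n + m - 1 = i + (k + 1) * (n - 1)" "m + n - 1 = i + (k + 1) * (n - 1)"
    using n by (auto simp: m_def)
  have "gerstenhaber_product scale n m \<mu> \<phi> \<in> cochains scale (i + (k + 1) * (n - 1))"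
    "gerstenhaber_product scale m n \<phi> \<mu> \<in> cochains scale (i + (k + 1) * (n - 1))"
    using gerstenhaber_product_in_cochains[OF vs mu phi]
      gerstenhaber_product_in_cochains[OF vs phi mu] ar by (simp_all add: m_def)
  then show ?thesis
    unfolding cochains_def delta_def Let_def m_def[symmetric]
    by (auto intro!: VV.linear_compose_sub VV.linear_compose_scale_right)
qed

end

theory Submission
  imports Defs
begin

text \<open>
  Up to sign, \<open>\<delta> \<phi>\<close> is the graded commutator of \<open>\<phi>\<close> with \<open>\<mu>\<close>, where a cochain of arity \<open>m\<close> has
  degree \<open>m - 1\<close>; since \<open>n\<close> is even, \<open>\<mu>\<close> has odd degree. The associator
  \<open>(f \<bullet> g) \<bullet> h - f \<bullet> (g \<bullet> h)\<close> consists of the terms in which \<open>g\<close> and \<open>h\<close> are plugged into distinct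
  slots of \<open>f\<close>, so it is graded symmetric in \<open>g\<close> and \<open>h\<close>. As \<open>\<mu> \<bullet> \<mu> = 0\<close>, the symmetry for
  \<open>(\<mu>, \<mu>, \<phi>)\<close> and \<open>(\<phi>, \<mu>, \<mu>)\<close> cancels all the terms of \<open>\<delta> (\<delta> \<phi>)\<close>.
\<close>

section \<open>Signs in an abelian group\<close>

text \<open>Every scalar in the formulas is a sign, so negation in the group can replace
  \<open>scale\<close>. Exponents are integers because a cochain of arity 0 has degree -1.\<close>

definition signed :: "int \<Rightarrow> 'v::ab_group_add \<Rightarrow> 'v"
  where "signed e x = (if even e then x else - x)"

lemma scale_minus_one_powi:
  fixes scale :: "'k::field_char_0 \<Rightarrow> 'v::ab_group_add \<Rightarrow> 'v"
  assumes "vector_space scale"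
  shows "scale ((-1) powi e) x = signed e x"
proof -
  interpret vector_space scale by (rule assms)
  show ?thesis by (cases "even e") (simp_all add: signed_def)
qed

lemma signed_zero [simp]: "signed e 0 = 0"
  by (simp add: signed_def)

lemma signed_signed: "signed a (signed b x) = signed (a + b) x"
  by (auto simp: signed_def)

lemma signed_diff: "signed e (x - y) = signed e x - signed e y"
  by (simp add: signed_def)

lemma signed_sum: "signed e (sum u A) = (\<Sum>a\<in>A. signed e (u a))"
  by (simp add: signed_def sum_negf)

lemma signed_parity_cong: "even (a + b) \<Longrightarrow> signed a x = signed b x"
  by (auto simp: signed_def)

section \<open>Additivity in each argument\<close>

text \<open>The form in which multilinearity enters: it pulls signs and finite sums out of any
  slot.\<close>

definition slotwise_additive :: "nat \<Rightarrow> ('v::ab_group_add list \<Rightarrow> 'v) \<Rightarrow> bool"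
  where "slotwise_additive r f \<longleftrightarrow> (\<forall>as bs. length as + 1 + length bs = r \<longrightarrow>
           (\<forall>x y. f (as @ (x + y) # bs) = f (as @ x # bs) + f (as @ y # bs)))"

lemma cochains_slotwise_additive: "f \<in> cochains scale r \<Longrightarrow> slotwise_additive r f"
  unfolding cochains_def slotwise_additive_def
  using module_hom.add[OF Vector_Spaces.linear.axioms(3)] by blast

context
  fixes r :: nat and f :: "'v::ab_group_add list \<Rightarrow> 'v" and as bs :: "'v list"
  assumes add: "slotwise_additive r f" and len: "length as + 1 + length bs = r"
begin

lemma slotwise_add: "f (as @ (x + y) # bs) = f (as @ x # bs) + f (as @ y # bs)"
  using add len by (auto simp: slotwise_additive_def)

lemma slotwise_zero: "f (as @ 0 # bs) = 0"
  using slotwise_add[of 0 0] by simp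

lemma slotwise_uminus: "f (as @ (- x) # bs) = - f (as @ x # bs)"
  using slotwise_add[of x "- x"] by (simp add: slotwise_zero minus_unique)

lemma slotwise_diff: "f (as @ (x - y) # bs) = f (as @ x # bs) - f (as @ y # bs)"
  using slotwise_add[of x "- y"] by (simp add: slotwise_uminus)

lemma slotwise_signed: "f (as @ signed e x # bs) = signed e (f (as @ x # bs))"
  by (simp add: signed_def slotwise_uminus)

lemma slotwise_sum: "f (as @ sum u A # bs) = (\<Sum>a\<in>A. f (as @ u a # bs))"
  by (induction A rule: infinite_finite_induct) (simp_all add: slotwise_zero slotwise_add)

end

section \<open>Associator of the Gerstenhaber product\<close>

lemma gerstenhaber_product_eq_sum:
  fixes scale :: "'k::field_char_0 \<Rightarrow> 'v::ab_group_add \<Rightarrow> 'v"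
  assumes "vector_space scale" and "length xs = r + s - 1"
  shows "gerstenhaber_product scale r s f g xs =
    (\<Sum>j<r. signed (int j * (int s - 1)) (f (take j xs @ g (take s (drop j xs)) # drop (j + s) xs)))"
proof -
  have "(\<Sum>j=1..r. u (j - 1)) = (\<Sum>j<r. u j)" for u :: "nat \<Rightarrow> 'v"
    by (simp add: sum.atLeast1_atMost_eq)
  from this[of "\<lambda>j. signed (int j * (int s - 1)) (f (take j xs @ g (take s (drop j xs)) # drop (j + s) xs))"]
  show ?thesis
    using assms(2)
    by (auto simp: gerstenhaber_product_def scale_minus_one_powi[OF assms(1)] of_nat_diff
        intro!: sum.cong elim!: trans[rotated])
qed

text \<open>
  The slots \<open>p < q\<close> of \<open>f\<close> are counted from \<open>0\<close>. As \<open>g\<close> consumes \<open>s\<close> arguments, the arguments of \<open>h\<close>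
  start at position \<open>q + s - 1\<close>; the subtraction does not truncate because \<open>q > 0\<close>.
\<close>

definition plug_two ::
  "nat \<Rightarrow> nat \<Rightarrow> ('v list \<Rightarrow> 'v) \<Rightarrow> ('v list \<Rightarrow> 'v) \<Rightarrow> ('v list \<Rightarrow> 'v) \<Rightarrow> nat \<Rightarrow> nat \<Rightarrow> 'v list \<Rightarrow> 'v"
  where "plug_two s t f g h p q xs =
    f (take p xs @ g (take s (drop p xs)) # take (q - p - 1) (drop (p + s) xs) @
       h (take t (drop (q + s - 1) xs)) # drop (q + s - 1 + t) xs)"

text \<open>Each insertion has the sign of its own slot in \<open>f\<close>. The sign caused by
  arguments that \<open>g\<close> consumes before \<open>h\<close> is kept out, so the same sum
  serves both orders of insertion.\<close>

definition plug_two_sum ::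
  "nat \<Rightarrow> nat \<Rightarrow> nat \<Rightarrow> ('v::ab_group_add list \<Rightarrow> 'v) \<Rightarrow> ('v list \<Rightarrow> 'v) \<Rightarrow> ('v list \<Rightarrow> 'v) \<Rightarrow> 'v list \<Rightarrow> 'v"
  where "plug_two_sum r s t f g h xs =
    (\<Sum>q<r. \<Sum>p<q. signed (int p * (int s - 1) + int q * (int t - 1)) (plug_two s t f g h p q xs))"

text \<open>This is the graded pre-Lie identity. Either \<open>h\<close> lands among the arguments
  of \<open>g\<close>, which gives f \<bullet> (g \<bullet> h), or it fills another slot of
  \<open>f\<close>, left or right of \<open>g\<close>. The premise \<open>s + t \<ge> 1\<close>
  keeps the arity of g \<bullet> h from truncating.\<close>

lemma gerstenhaber_associator:
  fixes scale :: "'k::field_char_0 \<Rightarrow> 'v::ab_group_add \<Rightarrow> 'v"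
  assumes vs: "vector_space scale" and f: "slotwise_additive r f"
    and st: "s + t \<ge> 1" and len: "length xs + 2 = r + s + t"
  shows "gerstenhaber_product scale (r + s - 1) t (gerstenhaber_product scale r s f g) h xs =
    gerstenhaber_product scale r (s + t - 1) f (gerstenhaber_product scale s t g h) xs
    + plug_two_sum r t s f h g xs
    + signed ((int s - 1) * (int t - 1)) (plug_two_sum r s t f g h xs)"
proof (cases "r = 0")
  case True
  moreover have "gerstenhaber_product scale 0 b u v = (\<lambda>_. 0)" for b u v
    by (auto simp: gerstenhaber_product_def)
  moreover have "gerstenhaber_product scale a b (\<lambda>_. 0) v = (\<lambda>_. 0)" for a b v
    by (auto simp: gerstenhaber_product_def scale_minus_one_powi[OF vs])
  ultimately show ?thesis
    by (simp add: plug_two_sum_def)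
next
  case False
  \<comment> \<open>\<open>ys j\<close> is the argument list of f \<bullet> g once \<open>h\<close>
    is applied at position \<open>j\<close>; \<open>F i j\<close> is the signed term with
    \<open>g\<close> in slot \<open>i\<close> of \<open>f\<close>.\<close>
  define ys where "ys j = take j xs @ h (take t (drop j xs)) # drop (j + t) xs" for j
  define F where "F i j = signed (int i * (int s - 1) + int j * (int t - 1))
    (f (take i (ys j) @ g (take s (drop i (ys j))) # drop (i + s) (ys j)))" for i j
  have len_ys: "length (ys j) = r + s - 1" if "j < r + s - 1" for j
    using that len False by (simp add: ys_def)
  have "gerstenhaber_product scale (r + s - 1) t (gerstenhaber_product scale r s f g) h xs
      = (\<Sum>j<r + s - 1. \<Sum>i<r. F i j)"
    using len False len_ys
    by (subst gerstenhaber_product_eq_sum[OF vs])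
      (auto intro!: sum.cong simp: gerstenhaber_product_eq_sum[OF vs] F_def ys_def[symmetric]
        signed_sum signed_signed add.commute)
  also have "\<dots> = (\<Sum>i<r. \<Sum>j<r + s - 1. F i j)"
    by (rule sum.swap)
  \<comment> \<open>In slot \<open>i\<close>, \<open>g\<close> reads positions \<open>i\<close> to
    \<open>i + s - 1\<close> of \<open>ys j\<close>. The three ranges put the value of
    \<open>h\<close> inside, left and right of this block; the first is empty if
    \<open>s = 0\<close>.\<close>
  also have "\<dots> = (\<Sum>i<r. (\<Sum>j\<in>{i..<i + s}. F i j) + (\<Sum>j<i. F i j) + (\<Sum>j\<in>{i + s..<r + s - 1}. F i j))"
  proof (rule sum.cong)
    fix i assume "i \<in> {..<r}"
    then have "i + s \<le> r + s - 1"
      by simp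
    then show "(\<Sum>j<r + s - 1. F i j)
        = (\<Sum>j\<in>{i..<i + s}. F i j) + (\<Sum>j<i. F i j) + (\<Sum>j\<in>{i + s..<r + s - 1}. F i j)"
      using sum.atLeastLessThan_concat[of 0 i "i + s" "F i"]
        sum.atLeastLessThan_concat[of 0 "i + s" "r + s - 1" "F i"]
      by (simp add: lessThan_atLeast0 add.commute)
  qed simp
  also have "\<dots> = (\<Sum>i<r. \<Sum>j\<in>{i..<i + s}. F i j) + (\<Sum>i<r. \<Sum>j<i. F i j)
      + (\<Sum>i<r. \<Sum>j\<in>{i + s..<r + s - 1}. F i j)"
    by (simp add: sum.distrib)
  also have "(\<Sum>i<r. \<Sum>j\<in>{i..<i + s}. F i j)
      = gerstenhaber_product scale r (s + t - 1) f (gerstenhaber_product scale s t g h) xs"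
  proof -
    have "(\<Sum>j\<in>{i..<i + s}. F i j) = signed (int i * (int (s + t - 1) - 1))
        (f (take i xs @ gerstenhaber_product scale s t g h (take (s + t - 1) (drop i xs)) #
            drop (i + (s + t - 1)) xs))" if i: "i < r" for i
    proof -
      \<comment> \<open>These are the arguments of g \<bullet> h in slot \<open>i\<close> of
        \<open>f\<close>; below, \<open>l = j - i\<close> is the slot of \<open>h\<close> in
        \<open>g\<close>.\<close>
      define zs where "zs = take (s + t - 1) (drop i xs)"
      have len_zs: "length zs = s + t - 1"
        using i len st by (simp add: zs_def)
      have slot: "length (take i xs) + 1 + length (drop (i + (s + t - 1)) xs) = r"
        using i len st by simp
      have F: "F i (l + i) = signed (int i * (int (s + t - 1) - 1)) (signed (int l * (int t - 1))
          (f (take i xs @ g (take l zs @ h (take t (drop l zs)) # drop (l + t) zs) #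
            drop (i + (s + t - 1)) xs)))" if l: "l < s" for l
      proof -
        have 1: "take i (ys (l + i)) = take i xs"
          using i len l by (simp add: ys_def)
        have 2: "take s (drop i (ys (l + i))) = take l zs @ h (take t (drop l zs)) # drop (l + t) zs"
        proof -
          have "s - l = Suc (s - l - 1)" "s + t - Suc (l + t) = s - Suc l"
            using l by simp_all
          moreover have "s + t - Suc l \<ge> t" using l by simp
          ultimately show ?thesis
            using i len l
            by (simp add: ys_def zs_def drop_take min_def add_ac)
        qed
        have 3: "drop (i + s) (ys (l + i)) = drop (i + (s + t - 1)) xs"
        proof -
          have "i + s - (l + i) = Suc (s - l - 1)" using l by simp
          then show ?thesis using i len l by (simp add: ys_def add_ac)
        qed
        have "int i * (int s - 1) + int (l + i) * (int t - 1)
            = int i * (int (s + t - 1) - 1) + int l * (int t - 1)"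
          using st by (simp add: of_nat_diff algebra_simps)
        then show ?thesis
          by (simp only: F_def 1 2 3 signed_signed)
      qed
      have "(\<Sum>j\<in>{i..<i + s}. F i j) = (\<Sum>l<s. F i (l + i))"
        using sum.shift_bounds_nat_ivl[of "F i" 0 i s] by (simp add: lessThan_atLeast0 add.commute)
      also have "\<dots> = signed (int i * (int (s + t - 1) - 1))
        (f (take i xs @ gerstenhaber_product scale s t g h zs # drop (i + (s + t - 1)) xs))"
        \<comment> \<open>Additivity of \<open>f\<close> in slot \<open>i\<close> pulls out the
          signed sum that defines g \<bullet> h.\<close>
        unfolding gerstenhaber_product_eq_sum[OF vs len_zs] slotwise_sum[OF f slot]
          slotwise_signed[OF f slot] signed_sum
        by (intro sum.cong) (simp_all only: F lessThan_iff)
      finally show ?thesis by (simp add: zs_def)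
    qed
    then show ?thesis
      using len st False by (subst gerstenhaber_product_eq_sum[OF vs]) (auto intro!: sum.cong)
  qed
  \<comment> \<open>With \<open>h\<close> left of \<open>g\<close>, its position \<open>j\<close> is
    also its slot in \<open>f\<close>, so no extra sign appears.\<close>
  also have "(\<Sum>i<r. \<Sum>j<i. F i j) = plug_two_sum r t s f h g xs"
  proof -
    have "F i j = signed (int j * (int t - 1) + int i * (int s - 1)) (plug_two t s f h g j i xs)"
      if "j < i" "i < r" for i j
    proof -
      define d where "d = i - j - 1"
      have i: "i = j + Suc d" using that by (simp add: d_def)
      have "length (take j xs) = j" using that len by simp
      then show ?thesis
        using that len by (simp add: F_def plug_two_def ys_def i add_ac)
    qed
    then show ?thesis by (simp add: plug_two_sum_def)
  qed
  \<comment> \<open>With \<open>h\<close> in slot \<open>q\<close> right of \<open>g\<close>, its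
    position is \<open>q + s - 1\<close>; the shift by \<open>s - 1\<close> yields the constant sign
    in front.\<close>
  also have "(\<Sum>i<r. \<Sum>j\<in>{i + s..<r + s - 1}. F i j)
      = signed ((int s - 1) * (int t - 1)) (plug_two_sum r s t f g h xs)"
  proof -
    have F: "F i (q + s - 1) = signed ((int s - 1) * (int t - 1))
        (signed (int i * (int s - 1) + int q * (int t - 1)) (plug_two s t f g h i q xs))"
      if "i < q" "q < r" for i q
    proof -
      define d where "d = q - i - 1"
      have q: "q = i + Suc d" using that by (simp add: d_def)
      have "length (take (i + s + d) xs) = i + s + d" using that len q by simp
      then show ?thesis
        using that len
        by (simp add: F_def plug_two_def ys_def q signed_signed algebra_simps drop_take)
    qed
    have "(\<Sum>j\<in>{i + s..<r + s - 1}. F i j) = (\<Sum>q | q \<in> {..<r} \<and> i < q. F i (q + s - 1))" for i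
      by (rule sum.reindex_bij_witness[where i = "\<lambda>q. q + s - 1" and j = "\<lambda>j. j + 1 - s"]) auto
    then have "(\<Sum>i<r. \<Sum>j\<in>{i + s..<r + s - 1}. F i j)
        = (\<Sum>i<r. \<Sum>q | q \<in> {..<r} \<and> i < q. F i (q + s - 1))"
      by simp
    also have "\<dots> = (\<Sum>q<r. \<Sum>i | i \<in> {..<r} \<and> i < q. F i (q + s - 1))"
      by (rule sum.swap_restrict) auto
    also have "\<dots> = (\<Sum>q<r. \<Sum>i<q. F i (q + s - 1))"
      by (intro sum.cong) auto
    also have "\<dots> = signed ((int s - 1) * (int t - 1)) (plug_two_sum r s t f g h xs)"
      by (simp add: plug_two_sum_def signed_sum F del: One_nat_def)
    finally show ?thesis .
  qed
  finally show ?thesis .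
qed

section \<open>The square of the differential\<close>

theorem theorem1:
  fixes scale :: "'k::field_char_0 \<Rightarrow> 'v::ab_group_add \<Rightarrow> 'v"
    and n :: nat and \<mu> :: "'v list \<Rightarrow> 'v"
  assumes "vector_space scale"
    and "n \<ge> 2" and "even n"
    and "partially_associative scale n \<mu>"
  shows "\<forall>i\<in>{0..n - 2}. \<forall>k::nat. \<forall>\<phi>\<in>cochains scale (i + k * (n - 1)).
           (delta scale n \<mu> i (k + 1) \<circ> delta scale n \<mu> i k) \<phi> = (\<lambda>_. 0)"
proof (intro ballI allI ext)
  fix i k :: nat and \<phi> and xs :: "'v list"
  define m where "m = i + k * (n - 1)"
  define M where "M = m + n - 1"
  assume "\<phi> \<in> cochains scale (i + k * (n - 1))"
  then have phi: "slotwise_additive m \<phi>"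
    by (simp add: m_def cochains_slotwise_additive)
  have mu: "slotwise_additive n \<mu>" and mumu: "gerstenhaber_product scale n n \<mu> \<mu> = (\<lambda>_. 0)"
    using assms(4) by (auto simp: partially_associative_def intro: cochains_slotwise_additive)
  note vs = assms(1) and sum_eq = gerstenhaber_product_eq_sum[OF assms(1)]
  let ?e = "int m - 1"
  let ?G = "gerstenhaber_product scale"
  define P where "P = ?G n m \<mu> \<phi>"
  define Q where "Q = ?G m n \<phi> \<mu>"
  have M: "i + (k + 1) * (n - 1) = M"
    using assms(2) by (simp add: M_def m_def)
  have delta1: "delta scale n \<mu> i k \<phi> = (\<lambda>zs. signed ?e (P zs) - Q zs)"
    by (simp add: delta_def Let_def m_def P_def Q_def scale_minus_one_powi[OF vs])
  have delta2: "delta scale n \<mu> i (k + 1) \<psi> ys = signed (int M - 1) (?G n M \<mu> \<psi> ys) - ?G M n \<psi> \<mu> ys"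
    for \<psi> ys
    unfolding delta_def Let_def M by (simp add: scale_minus_one_powi[OF vs])
  \<comment> \<open>M - 1 is the sum of m - 1 and the odd number n - 1.\<close>
  have sign_M: "signed (int M - 1) x = - signed ?e x" for x :: 'v
    using assms(2,3) by (auto simp: signed_def M_def of_nat_diff)
  have "delta scale n \<mu> i (k + 1) (delta scale n \<mu> i k \<phi>) xs = 0"
  proof (cases "length xs = M + n - 1")
    case False
    then show ?thesis
      unfolding delta2 by (simp add: gerstenhaber_product_def add.commute)
  next
    case True
    have len: "length xs + 2 = m + n + n" "length xs + 2 = n + n + m" "length xs + 2 = n + m + n"
      "length xs = n + M - 1"
      using True assms(2) by (auto simp: M_def)
    \<comment> \<open>Here additivity of \<open>\<mu>\<close> in the slot receiving the cochain is
      used; in \<open>inner\<close> the cochain is the outer map, so evaluation is already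
      pointwise.\<close>
    have outer: "?G n M \<mu> (\<lambda>zs. signed ?e (P zs) - Q zs) xs = signed ?e (?G n M \<mu> P xs) - ?G n M \<mu> Q xs"
    proof -
      have "length (take j xs) + 1 + length (drop (j + M) xs) = n" if "j < n" for j
        using that len(4) by simp
      then show ?thesis
        unfolding sum_eq[OF len(4)] signed_sum sum_subtractf[symmetric]
        by (intro sum.cong)
          (simp_all add: slotwise_diff[OF mu] slotwise_signed[OF mu] signed_diff signed_signed add.commute)
    qed
    have inner: "?G M n (\<lambda>zs. signed ?e (P zs) - Q zs) \<mu> xs = signed ?e (?G M n P \<mu> xs) - ?G M n Q \<mu> xs"
      unfolding sum_eq[OF True] signed_sum sum_subtractf[symmetric]
      by (simp add: signed_diff signed_signed add.commute)
    have zero_left: "?G (n + n - 1) m (\<lambda>_. 0) \<phi> xs = 0"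
      using len assms(2) by (subst sum_eq) auto
    have zero_right: "?G m (n + n - 1) \<phi> (\<lambda>_. 0) xs = 0"
      using len assms(2)
      by (subst sum_eq) (auto intro!: sum.neutral simp: slotwise_zero[OF phi])
    \<comment> \<open>For (\<phi>, \<mu>, \<mu>) the two plug sums coincide, and (n - 1)^2 is odd,
      so they cancel.\<close>
    have A1: "?G M n Q \<mu> xs = 0"
    proof -
      have "?G M n Q \<mu> xs = plug_two_sum m n n \<phi> \<mu> \<mu> xs
          + signed ((int n - 1) * (int n - 1)) (plug_two_sum m n n \<phi> \<mu> \<mu> xs)"
        using gerstenhaber_associator[OF vs phi _ len(1), of \<mu> \<mu>] assms(2) zero_right
        by (simp add: Q_def M_def mumu)
      then show ?thesis using assms(3) by (simp add: signed_def)
    qed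
    \<comment> \<open>The associator of (\<mu>, \<mu>, \<phi>), whose left-hand side vanishes by
      \<mu> \<bullet> \<mu> = 0.\<close>
    have A2: "0 = ?G n M \<mu> P xs + plug_two_sum n m n \<mu> \<phi> \<mu> xs
        + signed ?e (plug_two_sum n n m \<mu> \<mu> \<phi> xs)"
    proof -
      have "signed ((int n - 1) * ?e) (plug_two_sum n n m \<mu> \<mu> \<phi> xs)
          = signed ?e (plug_two_sum n n m \<mu> \<mu> \<phi> xs)"
        using assms(3) by (intro signed_parity_cong) auto
      then show ?thesis
        using gerstenhaber_associator[OF vs mu _ len(2), of \<mu> \<phi>] assms(2) zero_left
        by (simp add: P_def M_def mumu add.commute)
    qed
    \<comment> \<open>The associator of (\<mu>, \<phi>, \<mu>) produces the plug sums of
      \<open>A2\<close> with the sign \<open>?e\<close> on the other one.\<close>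
    have A3: "?G M n P \<mu> xs = ?G n M \<mu> Q xs + plug_two_sum n n m \<mu> \<mu> \<phi> xs
        + signed ?e (plug_two_sum n m n \<mu> \<phi> \<mu> xs)"
    proof -
      have "signed (?e * (int n - 1)) (plug_two_sum n m n \<mu> \<phi> \<mu> xs)
          = signed ?e (plug_two_sum n m n \<mu> \<phi> \<mu> xs)"
        using assms(3) by (intro signed_parity_cong) auto
      then show ?thesis
        using gerstenhaber_associator[OF vs mu _ len(3), of \<phi> \<mu>] assms(2)
        by (simp add: P_def Q_def M_def add.commute)
    qed
    \<comment> \<open>After \<open>A1\<close> and \<open>A3\<close> the two copies of \<mu>
      \<bullet> Q cancel. Applying the sign \<open>?e\<close> twice is the identity, so minus the
      right-hand side of \<open>A2\<close> remains.\<close>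
    show ?thesis
      unfolding delta1 delta2 sign_M outer inner A1 A3
      using A2 by (cases "even ?e") (simp_all add: signed_def algebra_simps)
  qed
  then show "(delta scale n \<mu> i (k + 1) \<circ> delta scale n \<mu> i k) \<phi> xs = 0"
    by simp
qed

end
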